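(* Let $p\equiv 1\pmod 6$ be a prime and let $a$ be an integer with $p\nmid a$. For every $y\in\mathbb{F}_p$, the sum of the abscissae $x$ of the points $(x,y)\in\mathbb{F}_p\times\mathbb{F}_p$ on the curve $y^{2}\equiv x^{3}+a^{3}\pmod p$ having this same ordinate $y$ is congruent to zero modulo $p$.
   Context: The abscissa and ordinate of an affine point $(x,y)$ are $x$ and $y$ respectively. If there is no point with the given ordinate, the sum is understood to be $0$. *)

theory Defs
  imports "HOL-Number_Theory.Cong" "HOL-Computational_Algebra.Primes"
begin

text \<open>Elements of $F_p$ are represented by their least nonnegative residues, so that the affine
  points of the curve form a finite set of pairs of integers.\<close>

definition affine_points :: "int \<Rightarrow> int \<Rightarrow> (int \<times> int) set" where
  "affine_points p a =
    {(x, y). x \<in> {0..<p} \<and> y \<in> {0..<p} \<and> [y ^ 2 = x ^ 3 + a ^ 3] (mod p)}"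

end

theory Submission
  imports Defs "HOL-Number_Theory.Residue_Primitive_Roots"
begin

text \<open>
  The points with ordinate \<open>y\<close> have as abscissae the cube roots of \<open>y\<^sup>2 - a\<^sup>3\<close> modulo \<open>p\<close>.
  Since \<open>3\<close> divides \<open>p - 1\<close>, there is a cube root of unity \<open>w\<close> other than \<open>1\<close>, and multiplication
  by \<open>w\<close> permutes these abscissae. Their sum \<open>s\<close> therefore satisfies \<open>s = w s\<close>, that is,
  \<open>(w - 1) s = 0\<close> in a field, whence \<open>s = 0\<close>. The argument works for \<open>n\<close>-th roots of any residue
  whenever a nontrivial \<open>n\<close>-th root of unity exists (\<open>sum_nth_roots_cong_0\<close>), and
  a power of a primitive root supplies one for each \<open>n > 1\<close> dividing \<open>p - 1\<close>
  (\<open>ex_nontrivial_root_of_unity\<close>).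
\<close>

text \<open>The witness is \<open>g ^ k\<close> for a primitive root \<open>g\<close> and \<open>k = (p - 1) / n\<close>: as \<open>g\<close> has order
  \<open>p - 1 = k n\<close> and \<open>0 < k < k n\<close>, it is the \<open>n\<close>-th power, not \<open>g ^ k\<close> itself, that is \<open>1\<close>.\<close>

lemma ex_nontrivial_root_of_unity:
  fixes p n :: nat
  assumes "prime p" "n dvd p - 1" "n > 1"
  obtains w :: nat where "[w ^ n = 1] (mod p)" "\<not> [w = 1] (mod p)"
proof -
  obtain g where g: "residue_primroot p g"
    using prime_primitive_root_exists[of p] assms(1) prime_gt_1_nat by blast
  then have ord_g: "ord p g = p - 1"
    using assms(1) by (simp add: residue_primroot_def totient_prime)
  define k where "k = (p - 1) div n"
  have p1: "p - 1 = k * n" and "p - 1 > 0"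
    using assms prime_gt_1_nat[of p] by (auto simp: k_def)
  then have "k > 0" "k < p - 1"
    using assms(3) by (auto intro!: Nat.gr0I)
  then have "\<not> p - 1 dvd k"
    by (auto dest: dvd_imp_le)
  then have "\<not> [g ^ k = 1] (mod p)"
    using ord_g ord_divides[of g k p] by simp
  moreover have "[(g ^ k) ^ n = 1] (mod p)"
    using ord_g ord_divides[of g "k * n" p] p1 by (simp add: power_mult)
  ultimately show thesis
    using that by blast
qed

text \<open>As \<open>w\<close> is invertible modulo \<open>p\<close>, multiplication by it maps the finite set of roots
  injectively into, hence onto, itself. Reindexing by this permutation multiplies the sum by
  \<open>w\<close> without changing it, and \<open>w - 1\<close> can be cancelled.\<close>

lemma sum_nth_roots_cong_0:
  fixes p w c :: int
  assumes "prime p" "[w ^ n = 1] (mod p)" "\<not> [w = 1] (mod p)" "n > 0"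
  shows "[(\<Sum>x\<in>{x \<in> {0..<p}. [x ^ n = c] (mod p)}. x) = 0] (mod p)"
proof -
  define S where "S = {x \<in> {0..<p}. [x ^ n = c] (mod p)}"
  define f where "f = (\<lambda>x. (w * x) mod p)"
  have "p > 0" using assms(1) prime_gt_0_int by blast
  have "\<not> p dvd w"
  proof
    assume "p dvd w"
    then have "[w ^ n = 0] (mod p)"
      using assms(4) by (auto simp: cong_0_iff intro: dvd_trans[OF _ dvd_power])
    then have "[1 = 0] (mod p)" using assms(2) cong_sym cong_trans by blast
    then show False using prime_gt_1_int[OF assms(1)] by (simp add: cong_0_iff)
  qed
  then have "coprime w p"
    using assms(1) prime_imp_coprime coprime_commute by blast
  have "inj_on f S"
  proof (rule inj_onI)
    fix x y assume xy: "x \<in> S" "y \<in> S" "f x = f y"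
    then have "[w * x = w * y] (mod p)" by (simp add: f_def cong_def)
    then have "[x = y] (mod p)" using \<open>coprime w p\<close> cong_mult_lcancel by blast
    then show "x = y" using xy by (auto simp: S_def intro: cong_less_imp_eq_int)
  qed
  moreover have "f ` S \<subseteq> S"
  proof
    fix z assume "z \<in> f ` S"
    then obtain x where x: "x \<in> S" "z = (w * x) mod p" by (auto simp: f_def)
    have "[z ^ n = (w * x) ^ n] (mod p)"
      using x by (intro cong_pow) simp
    also have "(w * x) ^ n = w ^ n * x ^ n" by (simp add: power_mult_distrib)
    also have "[\<dots> = 1 * c] (mod p)"
      using assms(2) x by (intro cong_mult) (simp_all add: S_def)
    finally show "z \<in> S" using \<open>p > 0\<close> x by (simp add: S_def)
  qed
  moreover have "finite S"
    by (rule finite_subset[of _ "{0..<p}"]) (auto simp: S_def)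
  ultimately have "bij_betw f S S"
    by (simp add: bij_betw_def endo_inj_surj)
  then have "(\<Sum>x\<in>S. x) = (\<Sum>x\<in>S. f x)"
    using sum.reindex_bij_betw[of f S S "\<lambda>x. x"] by simp
  also have "[\<dots> = (\<Sum>x\<in>S. w * x)] (mod p)"
    by (intro cong_sum) (simp add: f_def)
  also have "(\<Sum>x\<in>S. w * x) = w * (\<Sum>x\<in>S. x)" by (simp add: sum_distrib_left)
  finally have "p dvd (w - 1) * (\<Sum>x\<in>S. x)"
    by (simp add: cong_iff_dvd_diff dvd_diff_commute left_diff_distrib)
  moreover have "\<not> p dvd w - 1" using assms(3) by (simp add: cong_iff_dvd_diff)
  ultimately show ?thesis
    using assms(1) by (simp add: prime_dvd_mult_iff cong_0_iff S_def)
qed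

theorem theorem8:
  fixes p a y :: int
  assumes "prime p"
    and "[p = 1] (mod 6)"
    and "\<not> p dvd a"
    and "y \<in> {0..<p}"
  shows "[(\<Sum>P\<in>{P \<in> affine_points p a. snd P = y}. fst P) = 0] (mod p)"
proof -
  define S where "S = {x \<in> {0..<p}. [x ^ 3 = y ^ 2 - a ^ 3] (mod p)}"
  have curve_iff: "[y ^ 2 = x ^ 3 + a ^ 3] (mod p) \<longleftrightarrow> [x ^ 3 = y ^ 2 - a ^ 3] (mod p)" for x
    by (subst cong_sym_eq) (simp add: cong_iff_dvd_diff algebra_simps)
  have points: "{P \<in> affine_points p a. snd P = y} = (\<lambda>x. (x, y)) ` S"
    using assms(4) by (auto simp: affine_points_def S_def curve_iff)
  have sum_eq: "(\<Sum>P\<in>{P \<in> affine_points p a. snd P = y}. fst P) = (\<Sum>x\<in>S. x)"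
    unfolding points by (subst sum.reindex) (auto simp: inj_on_def)
  obtain q where q: "p = int q" "prime q"
    using assms(1) by (metis prime_int_nat_transfer prime_ge_0_int int_nat_eq)
  have "3 dvd q - 1"
  proof -
    have "p mod 6 = 1" using assms(2) by (simp add: cong_def)
    then show ?thesis unfolding q(1) by presburger
  qed
  then obtain w where w: "[w ^ 3 = 1] (mod q)" "\<not> [w = 1] (mod q)"
    using ex_nontrivial_root_of_unity[of q 3] q(2) by auto
  have "[int w ^ 3 = 1] (mod p)" "\<not> [int w = 1] (mod p)"
    using w cong_int_iff[of "w ^ 3" 1 q] cong_int_iff[of w 1 q] by (simp_all add: q(1))
  then show ?thesis
    unfolding sum_eq S_def using assms(1) by (intro sum_nth_roots_cong_0) auto
qed

end
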